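(* Let $A$ be the simple graph with vertex set $\{1,2,3,4,5,6,7\}$ and exactly the following $12$ edges: $\{1,2\}$, $\{1,3\}$, $\{1,6\}$, $\{2,4\}$, $\{2,5\}$, $\{3,7\}$, $\{4,7\}$, $\{5,7\}$, $\{6,7\}$, $\{3,4\}$, $\{4,5\}$, $\{5,6\}$. Then $A$ does not admit a semi-transitive orientation.
   Context: An orientation of a simple graph assigns to each edge exactly one of its two possible directions, yielding a digraph. A digraph with vertex set $V$ and arc set $E$ is semi-transitive if it has no directed cycles and, for every directed path $v_1v_2\cdots v_k$ (distinct vertices $v_i\in V$ with arcs $v_i\to v_{i+1}$ for $1\le i<k$) with $k\ge 4$, either $v_1v_k\notin E$ or $v_iv_j\in E$ for all $1\le i<j\le k$ (where $v_iv_j$ denotes the arc directed from $v_i$ to $v_j$). A graph admits a semi-transitive orientation if some orientation of it is a semi-transitive digraph. *)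

theory Defs
  imports "Graph_Theory.Pair_Digraph" "Graph_Theory.Vertex_Walk"
begin

text \<open>
  An undirected simple graph is a symmetric, loop-free pair digraph (locale \<^locale>\<open>pair_graph\<close>),
  the edge \<open>{u, v}\<close> being represented by the two arcs \<open>(u, v)\<close> and \<open>(v, u)\<close>.
\<close>

definition orientation :: "'a pair_pre_digraph \<Rightarrow> 'a pair_pre_digraph \<Rightarrow> bool" where
  "orientation D G \<longleftrightarrow>
     pverts D = pverts G \<and> parcs D \<subseteq> parcs G \<and>
     (\<forall>(u, v) \<in> parcs G. (u, v) \<in> parcs D \<longleftrightarrow> (v, u) \<notin> parcs D)"

text \<open>
  A \<^const>\<open>vpath\<close> is a nonempty list of distinct vertices with consecutive ones joined by
  arcs; list positions start at 0, so \<open>v\<^sub>i\<close> is \<open>p ! (i - 1)\<close>.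
\<close>

definition semi_transitive :: "('a, 'b) pre_digraph \<Rightarrow> bool" where
  "semi_transitive D \<longleftrightarrow>
     (\<nexists>c. pre_digraph.cycle D c) \<and>
     (\<forall>p. vpath p D \<and> 4 \<le> length p \<longrightarrow>
        \<not> hd p \<rightarrow>\<^bsub>D\<^esub> last p \<or>
        (\<forall>i j. i < j \<and> j < length p \<longrightarrow> p ! i \<rightarrow>\<^bsub>D\<^esub> p ! j))"

definition admits_semi_transitive_orientation :: "'a pair_pre_digraph \<Rightarrow> bool" where
  "admits_semi_transitive_orientation G \<longleftrightarrow>
     (\<exists>D. orientation D G \<and> semi_transitive (with_proj D))"

definition graph_of_edges :: "'a set \<Rightarrow> 'a set set \<Rightarrow> 'a pair_pre_digraph" where
  "graph_of_edges V E = \<lparr> pverts = V, parcs = {(u, v). {u, v} \<in> E} \<rparr>"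

lemma pair_graph_graph_of_edges:
  assumes "finite V" and "\<And>e. e \<in> E \<Longrightarrow> e \<subseteq> V \<and> card e = 2"
  shows "pair_graph (graph_of_edges V E)"
proof
  let ?G = "graph_of_edges V E"
  have sub: "parcs ?G \<subseteq> V \<times> V"
    using assms(2) by (fastforce simp: graph_of_edges_def)
  show "finite (pverts ?G)" using assms(1) by (simp add: graph_of_edges_def)
  show "finite (parcs ?G)" using sub assms(1) by (meson finite_SigmaI finite_subset)
  show "fst e \<in> pverts ?G" "snd e \<in> pverts ?G" if "e \<in> parcs ?G" for e
    using sub that by (auto simp: graph_of_edges_def)
  show "fst e \<noteq> snd e" if "e \<in> parcs ?G" for e
    using assms(2)[of "{fst e, snd e}"] that by (auto simp: graph_of_edges_def)
  show "symmetric (with_proj ?G)"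
    by (auto simp: symmetric_def sym_def graph_of_edges_def insert_commute arcs_ends_conv)
qed

definition graph_A :: "nat pair_pre_digraph" where
  "graph_A = graph_of_edges {1, 2, 3, 4, 5, 6, 7}
     {{1, 2}, {1, 3}, {1, 6}, {2, 4}, {2, 5}, {3, 7}, {4, 7}, {5, 7}, {6, 7}, {3, 4}, {4, 5}, {5, 6}}"

lemma pair_graph_graph_A: "pair_graph graph_A"
  unfolding graph_A_def by (rule pair_graph_graph_of_edges) auto

end

theory Submission
  imports Defs
begin

text \<open>
  Give every edge traversed along its orientation the sign 1 and every edge traversed against it
  the sign -1. In a semi-transitive orientation the signs around a 4-cycle with a missing diagonal
  sum to 0: an excess of arcs in one direction is a directed cycle or a path of three arcs with a
  shortcut. Orient the triangles 245, 347, 457, 567 consistently. Each of the other three forms such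
  a 4-cycle with 457, so if 457 has sum \<open>t\<close>, they have sum \<open>-t\<close>, and the hexagon 3-4-2-5-6-7
  bounding the union of the four has sum \<open>-2 t \<noteq> 0\<close>, as \<open>t\<close> is odd. But the sums
  around the 4-cycles 1-3-4-2, 1-2-5-6, 1-6-7-3, all with a missing diagonal, add up to that of the
  hexagon, which is therefore 0.
\<close>

text \<open>The value -1 on non-adjacent pairs makes oddness unconditional; antisymmetry still needs
  an edge.\<close>

definition arc_sign :: "'a pair_pre_digraph \<Rightarrow> 'a \<Rightarrow> 'a \<Rightarrow> int" where
  "arc_sign D u v = (if (u, v) \<in> parcs D then 1 else -1)"

lemma odd_arc_sign [simp]: "odd (arc_sign D u v)"
  by (simp add: arc_sign_def)

lemma arc_sign_swap:
  assumes "orientation D G" "(u, v) \<in> parcs G"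
  shows "arc_sign D v u = - arc_sign D u v"
  using assms by (auto simp: orientation_def arc_sign_def)

lemma semi_transitive_path4_no_back_arc:
  assumes "semi_transitive (with_proj D)" "{a, b, c, d} \<subseteq> pverts D" "distinct [a, b, c, d]"
    and "(a, b) \<in> parcs D" "(b, c) \<in> parcs D" "(c, d) \<in> parcs D"
  shows "(d, a) \<notin> parcs D"
proof
  assume "(d, a) \<in> parcs D"
  then have "pre_digraph.cycle (with_proj D) [(a, b), (b, c), (c, d), (d, a)]"
    using assms unfolding pre_digraph.cycle_def pre_digraph.awalk_def
    by (auto simp: pre_digraph.cas.simps pre_digraph.awalk_verts.simps)
  then show False
    using assms(1) by (auto simp: semi_transitive_def)
qed

lemma semi_transitive_path4_shortcut:
  assumes "semi_transitive (with_proj D)" "{a, b, c, d} \<subseteq> pverts D" "distinct [a, b, c, d]"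
    and "(a, b) \<in> parcs D" "(b, c) \<in> parcs D" "(c, d) \<in> parcs D" "(a, d) \<in> parcs D"
  shows "(a, c) \<in> parcs D" "(b, d) \<in> parcs D"
proof -
  have "vpath [a, b, c, d] (with_proj D)"
    using assms by (simp add: vpath_def vwalk_def)
  then have "\<forall>i j. i < j \<and> j < 4 \<longrightarrow> ([a, b, c, d] ! i, [a, b, c, d] ! j) \<in> parcs D"
    using assms(1,7) unfolding semi_transitive_def by (force simp: numeral_eq_Suc)
  from this[rule_format, of 0 2] this[rule_format, of 1 3]
  show "(a, c) \<in> parcs D" "(b, d) \<in> parcs D"
    by (simp_all add: numeral_eq_Suc)
qed

text \<open>A nonzero sum of four signs has three equal ones, and these are always consecutive
  around the cycle. They form a path whose two chords are the diagonals of the 4-cycle, so the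
  missing diagonal is one of them wherever the path starts.\<close>

lemma semi_transitive_four_cycle_balanced:
  assumes "pair_graph G" "orientation D G" "semi_transitive (with_proj D)"
    and "distinct [a, b, c, d]"
    and edges: "(a, b) \<in> parcs G" "(b, c) \<in> parcs G" "(c, d) \<in> parcs G" "(d, a) \<in> parcs G"
    and "(a, c) \<notin> parcs G"
  shows "arc_sign D a b + arc_sign D b c + arc_sign D c d + arc_sign D d a = 0"
proof -
  interpret pair_graph G by fact
  have verts: "a \<in> pverts D" "b \<in> pverts D" "c \<in> pverts D" "d \<in> pverts D"
    using edges assms(2) by (auto simp: orientation_def dest: in_arcsD1)
  have diag: "(a, c) \<notin> parcs D" "(c, a) \<notin> parcs D"
    using assms(2,9) arcs_symmetric by (auto simp: orientation_def)
  have flip: "(v, u) \<in> parcs D \<longleftrightarrow> (u, v) \<notin> parcs D" if "(u, v) \<in> parcs G" for u v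
    using assms(2) that by (auto simp: orientation_def)
  have no_path: "\<not> ((w, x) \<in> parcs D \<and> (x, y) \<in> parcs D \<and> (y, z) \<in> parcs D)"
    if "{w, x, y, z} \<subseteq> pverts D" "distinct [w, x, y, z]" "(w, z) \<in> parcs D \<or> (z, w) \<in> parcs D"
      "(w, y) \<notin> parcs D \<or> (x, z) \<notin> parcs D" for w x y z
    using semi_transitive_path4_no_back_arc[OF assms(3) that(1,2)]
      semi_transitive_path4_shortcut[OF assms(3) that(1,2)] that(3,4) by blast
  \<comment> \<open>Four starting points in each of the two directions.\<close>
  have "\<not> ((a, b) \<in> parcs D \<and> (b, c) \<in> parcs D \<and> (c, d) \<in> parcs D)"
    "\<not> ((b, c) \<in> parcs D \<and> (c, d) \<in> parcs D \<and> (d, a) \<in> parcs D)"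
    "\<not> ((c, d) \<in> parcs D \<and> (d, a) \<in> parcs D \<and> (a, b) \<in> parcs D)"
    "\<not> ((d, a) \<in> parcs D \<and> (a, b) \<in> parcs D \<and> (b, c) \<in> parcs D)"
    "\<not> ((a, d) \<in> parcs D \<and> (d, c) \<in> parcs D \<and> (c, b) \<in> parcs D)"
    "\<not> ((d, c) \<in> parcs D \<and> (c, b) \<in> parcs D \<and> (b, a) \<in> parcs D)"
    "\<not> ((c, b) \<in> parcs D \<and> (b, a) \<in> parcs D \<and> (a, d) \<in> parcs D)"
    "\<not> ((b, a) \<in> parcs D \<and> (a, d) \<in> parcs D \<and> (d, c) \<in> parcs D)"
    using assms(4) verts diag edges[THEN flip] by (intro no_path; auto)+
  then show ?thesis
    using edges[THEN flip]
    by (cases "(a, b) \<in> parcs D"; cases "(b, c) \<in> parcs D"; cases "(c, d) \<in> parcs D";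
        cases "(d, a) \<in> parcs D"; simp add: arc_sign_def)
qed

theorem theorem4:
  shows "\<not> admits_semi_transitive_orientation graph_A"
proof
  assume "admits_semi_transitive_orientation graph_A"
  then obtain D where D: "orientation D graph_A" "semi_transitive (with_proj D)"
    by (auto simp: admits_semi_transitive_orientation_def)
  let ?s = "arc_sign D"
  have edge: "(u, v) \<in> parcs graph_A \<longleftrightarrow> {u, v} \<in>
      {{1, 2}, {1, 3}, {1, 6}, {2, 4}, {2, 5}, {3, 7}, {4, 7}, {5, 7}, {6, 7}, {3, 4}, {4, 5}, {5, 6}}"
    for u v
    by (simp add: graph_A_def graph_of_edges_def)
  note balanced = semi_transitive_four_cycle_balanced[OF pair_graph_graph_A D]
  note swap = arc_sign_swap[OF D(1)]
  \<comment> \<open>Each cycle is listed so that its first and third vertices are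
    non-adjacent.\<close>
  have "?s 1 3 + ?s 3 4 + ?s 4 2 + ?s 2 1 = 0" "?s 1 2 + ?s 2 5 + ?s 5 6 + ?s 6 1 = 0"
    "?s 1 6 + ?s 6 7 + ?s 7 3 + ?s 3 1 = 0" "?s 3 4 + ?s 4 5 + ?s 5 7 + ?s 7 3 = 0"
    "?s 4 5 + ?s 5 6 + ?s 6 7 + ?s 7 4 = 0" "?s 2 5 + ?s 5 7 + ?s 7 4 + ?s 4 2 = 0"
    by (rule balanced; simp add: edge doubleton_eq_iff)+
  moreover have "?s 2 1 = - ?s 1 2" "?s 3 1 = - ?s 1 3" "?s 6 1 = - ?s 1 6"
    by (rule swap; simp add: edge doubleton_eq_iff)+
  \<comment> \<open>In the sum of the first three equations the edges at 1 cancel, leaving the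
    hexagon. The last three add up to the hexagon plus twice this sum, since each side of 457 lies
    on two of those cycles, in the same direction.\<close>
  ultimately have "?s 4 5 + ?s 5 7 + ?s 7 4 = 0"
    by linarith
  moreover have "odd (?s 4 5 + ?s 5 7 + ?s 7 4)"
    by simp
  ultimately show False
    by simp
qed

end
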